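(* Let $F$ be a forest of order $n\geq 1$. Then $$Q(F)\leq \frac{1}{4}n - \frac{1}{6}.$$
   Context: All graphs are finite and simple. For a graph $G$ and an integer $k\ge 0$, $\sigma_k(G)$ denotes the number of subsets $A\subseteq V(G)$ such that the subgraph of $G$ induced by $A$ has exactly $k$ edges. Thus $\sigma_0(G)$ is the number of independent vertex subsets of $G$ (including the empty set), and $\sigma_1(G)$ is the number of vertex subsets inducing exactly one edge. The ratio is $Q(G)=\sigma_1(G)/\sigma_0(G)$. The order of a graph is its number of vertices. *)

theory Defs
  imports Complex_Main
begin

record 'a graph =
  verts :: "'a set"
  edges :: "'a set set"

definition simple_graph :: "'a graph \<Rightarrow> bool" where
  "simple_graph G \<longleftrightarrow>
     finite (verts G) \<and> (\<forall>e \<in> edges G. e \<subseteq> verts G \<and> card e = 2)"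

definition induced_subgraph :: "'a graph \<Rightarrow> 'a set \<Rightarrow> 'a graph" where
  "induced_subgraph G A = \<lparr>verts = A, edges = {e \<in> edges G. e \<subseteq> A}\<rparr>"

text \<open>
  A cycle is given by the list of its vertices in cyclic order, the first vertex not being
  repeated at the end.
\<close>

definition is_cycle :: "'a graph \<Rightarrow> 'a list \<Rightarrow> bool" where
  "is_cycle G xs \<longleftrightarrow>
     3 \<le> length xs \<and> distinct xs \<and> set xs \<subseteq> verts G \<and>
     (\<forall>i < length xs. {xs ! i, xs ! (Suc i mod length xs)} \<in> edges G)"

definition forest :: "'a graph \<Rightarrow> bool" where
  "forest G \<longleftrightarrow> simple_graph G \<and> (\<nexists>xs. is_cycle G xs)"

definition sigma :: "nat \<Rightarrow> 'a graph \<Rightarrow> nat" where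
  "sigma k G = card {A. A \<subseteq> verts G \<and> card (edges (induced_subgraph G A)) = k}"

definition ratio_Q :: "'a graph \<Rightarrow> real" where
  "ratio_Q G = real (sigma 1 G) / real (sigma 0 G)"

lemma finite_edges:
  assumes "simple_graph G"
  shows "finite (edges G)"
proof (rule finite_subset)
  show "edges G \<subseteq> Pow (verts G)"
    using assms by (auto simp: simple_graph_def)
  show "finite (Pow (verts G))"
    using assms by (simp add: simple_graph_def)
qed

lemma sigma_0_independent_sets:
  assumes "simple_graph G"
  shows "sigma 0 G = card {A. A \<subseteq> verts G \<and> (\<forall>u \<in> A. \<forall>v \<in> A. {u, v} \<notin> edges G)}"
proof -
  have "card (edges (induced_subgraph G A)) = 0 \<longleftrightarrow>
      (\<forall>u \<in> A. \<forall>v \<in> A. {u, v} \<notin> edges G)" for A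
  proof -
    have "\<exists>u v. e = {u, v}" if "e \<in> edges G" for e
      using that assms unfolding simple_graph_def by (metis card_2_iff)
    then show ?thesis
      using finite_edges[OF assms] by (fastforce simp: induced_subgraph_def)
  qed
  then show ?thesis
    by (simp add: sigma_def)
qed

lemma sigma_0_pos:
  assumes "simple_graph G"
  shows "0 < sigma 0 G"
proof -
  have "finite {A. A \<subseteq> verts G \<and> (\<forall>u \<in> A. \<forall>v \<in> A. {u, v} \<notin> edges G)}"
    using assms by (simp add: simple_graph_def)
  then show ?thesis
    by (auto simp: sigma_0_independent_sets[OF assms] card_gt_0_iff)
qed

end

theory Submission
  imports Defs
begin

text \<open>
  Write \<open>i(S)\<close> and \<open>e(S)\<close> for the number of subsets of a vertex set \<open>S\<close> that induce no
  edge and exactly one edge. The bound is proved, cleared of denominators, as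
  \<open>12 e(S) + 2 i(S) \<le> 3 |S| i(S)\<close> for every nonempty set \<open>S\<close> of vertices of the forest, by
  induction on \<open>|S|\<close> (\<open>forest_count_bound\<close>). Working with all vertex sets of one fixed
  forest makes acyclicity of the smaller forests automatic.

  Splitting the counted sets by whether they contain a vertex \<open>v\<close>, with neighbourhood \<open>N\<close> in
  \<open>S\<close>, gives
  \<open>i(S) = i(S - v) + i(S - v - N)\<close> and
  \<open>e(S) = e(S - v) + e(S - v - N) + (\<Sum>u \<in> N. i(S - N[u] - N[v]))\<close>, where \<open>N[x]\<close> is the closed
  neighbourhood: the last sum counts the sets whose only edge is \<open>uv\<close>
  (\<open>count_independent_insert\<close>, \<open>count_one_edge_insert\<close>).

  An isolated vertex doubles both counts. If \<open>S\<close> spans an edge, then the second vertex \<open>v\<close> of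
  a longest path has \<open>k \<ge> 1\<close> leaves as neighbours and at most one other neighbour \<open>w\<close>
  (\<open>forest_has_vertex_beside_leaves\<close>). Let \<open>H\<close> be \<open>S\<close> without \<open>v\<close> and its leaves. Deleting
  \<open>v\<close> isolates the leaves, so \<open>i(S - v) = 2^k i(H)\<close> and \<open>e(S - v) = 2^k e(H)\<close>: these \<open>k\<close>
  vertices count towards the order but add nothing to the ratio of \<open>S - v\<close>. That gain has to
  pay for the sets having their edge at \<open>v\<close>. With \<open>x = i(H - w)\<close> and \<open>y = i(H - N[w])\<close>, so
  that \<open>i(H) = x + y\<close>, there are \<open>k x + y\<close> such sets, and it suffices that
  \<open>12 (k x + y) \<le> (3 k + 3) 2^k (x + y)\<close>, which holds with equality for \<open>k = 1\<close>. If there is no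
  \<open>w\<close>, then \<open>v\<close> and its leaves form a component that is a star, and \<open>H\<close> may be empty; the
  extremal case is a single edge, with ratio \<open>1/3\<close>.
\<close>

section \<open>Counting induced subgraphs inside a vertex set\<close>

definition edges_in :: "'a graph \<Rightarrow> 'a set \<Rightarrow> 'a set set" where
  "edges_in G A = {e \<in> edges G. e \<subseteq> A}"

definition sets_with_edges :: "'a graph \<Rightarrow> nat \<Rightarrow> 'a set \<Rightarrow> 'a set set" where
  "sets_with_edges G k S = {A. A \<subseteq> S \<and> card (edges_in G A) = k}"

definition nbrs :: "'a graph \<Rightarrow> 'a set \<Rightarrow> 'a \<Rightarrow> 'a set" where
  "nbrs G S v = {u \<in> S. {v, u} \<in> edges G}"

abbreviation count_sets :: "'a graph \<Rightarrow> nat \<Rightarrow> 'a set \<Rightarrow> nat" where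
  "count_sets G k S \<equiv> card (sets_with_edges G k S)"

lemma sigma_eq_count_sets: "sigma k G = count_sets G k (verts G)"
  by (simp add: sigma_def sets_with_edges_def edges_in_def induced_subgraph_def)

lemma finite_sets_with_edges: "finite S \<Longrightarrow> finite (sets_with_edges G k S)"
  by (auto simp: sets_with_edges_def)

lemma not_self_adjacent:
  assumes "simple_graph G"
  shows "{v, v} \<notin> edges G"
  using assms by (auto simp: simple_graph_def)

lemma adjacent_sym: "{u, v} \<in> edges G \<longleftrightarrow> {v, u} \<in> edges G"
  by (simp add: insert_commute)

lemma edges_in_empty:
  assumes "simple_graph G"
  shows "edges_in G {} = {}"
  using assms by (auto simp: edges_in_def simple_graph_def)

lemma card_edges_in_insert:
  assumes G: "simple_graph G" and "finite B" "v \<notin> B"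
  shows "card (edges_in G (insert v B)) = card (edges_in G B) + card (nbrs G B v)"
proof -
  have split: "edges_in G (insert v B) = edges_in G B \<union> (\<lambda>u. {v, u}) ` nbrs G B v"
  proof (intro equalityI subsetI)
    fix e assume e: "e \<in> edges_in G (insert v B)"
    then obtain a b where ab: "e = {a, b}" "a \<noteq> b"
      using G unfolding edges_in_def simple_graph_def by (metis (no_types, lifting) card_2_iff mem_Collect_eq)
    then show "e \<in> edges_in G B \<union> (\<lambda>u. {v, u}) ` nbrs G B v"
      using e by (auto simp: edges_in_def nbrs_def insert_commute)
  qed (auto simp: edges_in_def nbrs_def)
  have "inj_on (\<lambda>u. {v, u}) (nbrs G B v)"
    by (auto simp: inj_on_def doubleton_eq_iff)
  moreover have "edges_in G B \<inter> (\<lambda>u. {v, u}) ` nbrs G B v = {}"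
    using \<open>v \<notin> B\<close> by (auto simp: edges_in_def)
  moreover have "finite (edges_in G B)" "finite (nbrs G B v)"
    using finite_edges[OF G] \<open>finite B\<close> by (auto simp: edges_in_def nbrs_def)
  ultimately show ?thesis
    unfolding split by (simp add: card_Un_disjoint card_image)
qed

text \<open>
  Every set that contains \<open>v\<close> is determined by its remaining part \<open>B\<close>, to whose edges \<open>v\<close>
  adds one for each of its neighbours in \<open>B\<close>.
\<close>

lemma count_sets_insert:
  assumes G: "simple_graph G" and S: "finite S" "v \<notin> S"
  shows "count_sets G k (insert v S) = count_sets G k S
    + card {B. B \<subseteq> S \<and> card (edges_in G B) + card (nbrs G B v) = k}"
proof -
  let ?D = "{B. B \<subseteq> S \<and> card (edges_in G B) + card (nbrs G B v) = k}"
  have *: "card (edges_in G (insert v B)) = card (edges_in G B) + card (nbrs G B v)"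
    if "B \<subseteq> S" for B
    using that S by (intro card_edges_in_insert[OF G]) (auto intro: finite_subset)
  have split: "sets_with_edges G k (insert v S) = sets_with_edges G k S \<union> insert v ` ?D"
  proof (intro equalityI subsetI)
    fix A assume A: "A \<in> sets_with_edges G k (insert v S)"
    show "A \<in> sets_with_edges G k S \<union> insert v ` ?D"
    proof (cases "v \<in> A")
      case True
      then have "A = insert v (A - {v})" "A - {v} \<subseteq> S"
        using A by (auto simp: sets_with_edges_def)
      then show ?thesis
        using A *[of "A - {v}"] unfolding sets_with_edges_def
        by (metis (no_types, lifting) UnI2 image_eqI mem_Collect_eq)
    qed (use A in \<open>auto simp: sets_with_edges_def\<close>)
  qed (auto simp: sets_with_edges_def *)
  have "inj_on (insert v) ?D"
    using S by (intro inj_onI) (metis (no_types, lifting) insert_ident mem_Collect_eq subsetD)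
  moreover have "sets_with_edges G k S \<inter> insert v ` ?D = {}"
    using S by (auto simp: sets_with_edges_def)
  ultimately show ?thesis
    unfolding split using S by (simp add: card_Un_disjoint card_image finite_sets_with_edges)
qed

lemma nbrs_mono: "B \<subseteq> S \<Longrightarrow> nbrs G B v \<subseteq> nbrs G S v"
  by (auto simp: nbrs_def)

lemma finite_nbrs: "finite S \<Longrightarrow> finite (nbrs G S v)"
  by (simp add: nbrs_def)

lemma count_sets_insert_isolated:
  assumes G: "simple_graph G" and S: "finite S" "v \<notin> S" and "nbrs G S v = {}"
  shows "count_sets G k (insert v S) = 2 * count_sets G k S"
proof -
  have "{B. B \<subseteq> S \<and> card (edges_in G B) + card (nbrs G B v) = k} = sets_with_edges G k S"
    using nbrs_mono[of _ S G v] assms(4) by (auto simp: sets_with_edges_def)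
  then show ?thesis
    by (simp add: count_sets_insert[OF G S])
qed

text \<open>
  This is applied to the leaves \<open>L\<close> of a vertex that has just been deleted.
\<close>

lemma count_sets_Un_isolated:
  assumes G: "simple_graph G" and "finite L" "finite H" "L \<inter> H = {}"
    and "\<And>u. u \<in> L \<Longrightarrow> nbrs G (L \<union> H) u = {}"
  shows "count_sets G k (L \<union> H) = 2 ^ card L * count_sets G k H"
  using assms(2,4,5)
proof (induction L rule: finite_induct)
  case (insert u L)
  have iso: "nbrs G (L \<union> H) x = {}" if "x \<in> insert u L" for x
    using insert.prems(2)[OF that] nbrs_mono[of "L \<union> H" "insert u L \<union> H" G x] by auto
  have "count_sets G k (insert u (L \<union> H)) = 2 * count_sets G k (L \<union> H)"
    using insert iso \<open>finite H\<close> by (intro count_sets_insert_isolated[OF G]) auto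
  then show ?case
    using insert iso by simp
qed simp

lemma edges_in_zero_iff:
  assumes "simple_graph G"
  shows "card (edges_in G B) = 0 \<longleftrightarrow> (\<forall>a\<in>B. \<forall>b\<in>B. {a, b} \<notin> edges G)"
proof -
  have "\<exists>u v. e = {u, v}" if "e \<in> edges G" for e
    using that assms unfolding simple_graph_def by (metis card_2_iff)
  moreover have "finite (edges_in G B)"
    using finite_edges[OF assms] by (simp add: edges_in_def)
  ultimately show ?thesis
    by (fastforce simp: edges_in_def)
qed

lemma count_independent_insert:
  assumes G: "simple_graph G" and S: "finite S" "v \<notin> S"
  shows "count_sets G 0 (insert v S) = count_sets G 0 S + count_sets G 0 (S - nbrs G S v)"
proof -
  have "{B. B \<subseteq> S \<and> card (edges_in G B) + card (nbrs G B v) = 0}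
      = sets_with_edges G 0 (S - nbrs G S v)"
    using S(1) by (auto simp: sets_with_edges_def card_eq_0_iff finite_nbrs nbrs_def dest: finite_subset)
  then show ?thesis
    by (simp add: count_sets_insert[OF G S])
qed

text \<open>
  A set with exactly one edge that contains \<open>v\<close> either avoids all neighbours of \<open>v\<close>, and its
  edge lies in the rest, or it contains exactly one neighbour \<open>u\<close>. In the latter case \<open>uv\<close> is
  the edge, so what remains is an independent set without neighbours of \<open>u\<close> or \<open>v\<close>. The set
  \<open>nbrs G S v\<close> contains \<open>u\<close> and \<open>v\<close> is not in \<open>S\<close>, so open neighbourhoods suffice in the
  statement.
\<close>

lemma count_one_edge_insert:
  assumes G: "simple_graph G" and S: "finite S" "v \<notin> S"
  shows "count_sets G 1 (insert v S) = count_sets G 1 S + count_sets G 1 (S - nbrs G S v)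
    + (\<Sum>u \<in> nbrs G S v. count_sets G 0 (S - nbrs G S v - nbrs G S u))"
proof -
  let ?N = "nbrs G S v"
  let ?C = "\<lambda>u. sets_with_edges G 0 (S - ?N - nbrs G S u)"
  have split: "{B. B \<subseteq> S \<and> card (edges_in G B) + card (nbrs G B v) = 1}
      = sets_with_edges G 1 (S - ?N) \<union> (\<Union>u \<in> ?N. insert u ` ?C u)" (is "?D = ?A \<union> ?U")
  proof (intro equalityI subsetI)
    fix B assume B: "B \<in> ?D"
    then have fin: "finite (nbrs G B v)"
      using S by (auto intro: finite_subset finite_nbrs)
    consider "card (nbrs G B v) = 0" | "card (nbrs G B v) = 1" "card (edges_in G B) = 0"
      using B by force
    then show "B \<in> ?A \<union> ?U"
    proof cases
      case 1
      then have "nbrs G B v = {}"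
        using fin by simp
      then have "B \<subseteq> S - ?N" "card (edges_in G B) = 1"
        using B by (auto simp: nbrs_def[of G S])  (auto simp: nbrs_def)
      then show ?thesis
        by (simp add: sets_with_edges_def)
    next
      case 2
      then obtain u where u: "nbrs G B v = {u}"
        by (meson card_1_singletonE)
      then have uB: "u \<in> B" and adj: "{v, u} \<in> edges G" and uN: "u \<in> ?N"
        using B by (auto simp: nbrs_def)
      have ind: "\<And>a b. a \<in> B \<Longrightarrow> b \<in> B \<Longrightarrow> {a, b} \<notin> edges G"
        using 2 by (simp add: edges_in_zero_iff[OF G])
      have "B - {u} \<subseteq> S - ?N - nbrs G S u"
        using B u ind uB by (auto simp: nbrs_def)
      then have "B - {u} \<in> ?C u"
        using ind by (simp add: sets_with_edges_def edges_in_zero_iff[OF G])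
      then have "insert u (B - {u}) \<in> ?U"
        using uN by blast
      then show ?thesis
        using uB by (simp add: insert_absorb)
    qed
  next
    fix B assume "B \<in> ?A \<union> ?U"
    then consider "B \<in> ?A" | u C where "u \<in> ?N" "C \<in> ?C u" "B = insert u C"
      by blast
    then show "B \<in> ?D"
    proof cases
      case 1
      then have "nbrs G B v = {}"
        by (auto simp: sets_with_edges_def nbrs_def)
      then show ?thesis
        using 1 by (auto simp: sets_with_edges_def)
    next
      case 2
      have "\<And>a b. a \<in> C \<Longrightarrow> b \<in> C \<Longrightarrow> {a, b} \<notin> edges G"
        "\<And>a. a \<in> C \<Longrightarrow> {u, a} \<notin> edges G" and C: "C \<subseteq> S - ?N - nbrs G S u"
        using 2 by (auto simp: sets_with_edges_def edges_in_zero_iff[OF G] nbrs_def)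
      then have "card (edges_in G B) = 0"
        using 2 not_self_adjacent[OF G] unfolding edges_in_zero_iff[OF G]
        by (auto simp: insert_commute)
      moreover have "nbrs G B v = {u}"
        using 2 C by (auto simp: nbrs_def)
      ultimately show ?thesis
        using 2 C by (auto simp: nbrs_def)
    qed
  qed
  \<comment> \<open>The neighbour of \<open>v\<close> can be read off the set, which makes the union disjoint.\<close>
  have only: "B \<inter> ?N = {u}" if "u \<in> ?N" "B \<in> insert u ` ?C u" for u B
    using that by (auto simp: sets_with_edges_def)
  have "card ?U = (\<Sum>u \<in> ?N. card (insert u ` ?C u))"
  proof (rule card_UN_disjoint)
    show "\<forall>u\<in>?N. \<forall>u'\<in>?N. u \<noteq> u' \<longrightarrow> insert u ` ?C u \<inter> insert u' ` ?C u' = {}"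
      using only by (metis (no_types, lifting) disjoint_iff singleton_inject)
  qed (use S in \<open>auto simp: finite_nbrs finite_sets_with_edges\<close>)
  also have "\<dots> = (\<Sum>u \<in> ?N. count_sets G 0 (S - ?N - nbrs G S u))"
  proof (intro sum.cong refl card_image)
    fix u assume "u \<in> ?N"
    then have "\<And>C. C \<in> ?C u \<Longrightarrow> u \<notin> C"
      by (auto simp: sets_with_edges_def)
    then show "inj_on (insert u) (?C u)"
      by (metis (no_types, lifting) inj_onI insert_ident)
  qed
  finally have "card ?U = \<dots>" .
  moreover have "?A \<inter> ?U = {}"
    using only by (fastforce simp: sets_with_edges_def)
  ultimately have "card ?D = count_sets G 1 (S - ?N)
      + (\<Sum>u \<in> ?N. count_sets G 0 (S - ?N - nbrs G S u))"
    unfolding split using S by (subst card_Un_disjoint) (auto simp: finite_nbrs finite_sets_with_edges)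
  then show ?thesis
    by (simp add: count_sets_insert[OF G S])
qed

section \<open>A vertex next to leaves\<close>

text \<open>
  An edge from the first vertex of a path to a vertex beyond the second would close a cycle
  with the initial part of the path.
\<close>

lemma path_chord_free:
  assumes F: "forest F" and S: "set p \<subseteq> verts F" and "distinct p"
    and path: "successively (\<lambda>a b. {a, b} \<in> edges F) p"
    and j: "j < length p" "{p ! 0, p ! j} \<in> edges F"
  shows "j = 1"
proof (rule ccontr)
  assume "j \<noteq> 1"
  moreover have "j \<noteq> 0"
    using F j not_self_adjacent by (metis forest_def)
  ultimately have j2: "2 \<le> j" by linarith
  let ?c = "take (Suc j) p"
  have "is_cycle F ?c"
    unfolding is_cycle_def
  proof (intro conjI allI impI)
    show "set ?c \<subseteq> verts F"
      using S set_take_subset by fast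
    fix i assume "i < length ?c"
    then have i: "i < Suc j" by simp
    show "{?c ! i, ?c ! (Suc i mod length ?c)} \<in> edges F"
    proof (cases "i = j")
      case True
      then show ?thesis
        using j by (simp add: min_absorb2 insert_commute)
    next
      case False
      then show ?thesis
        using i j path by (simp add: min_absorb2 successively_conv_nth)
    qed
  qed (use j j2 \<open>distinct p\<close> in auto)
  then show False
    using F by (auto simp: forest_def)
qed

text \<open>
  Take a longest path \<open>x, v, w, ...\<close> inside \<open>S\<close>. By maximality the neighbours of its first
  vertex lie on the path, and by \<open>path_chord_free\<close> only \<open>v\<close> qualifies, so it is a leaf. A neighbour \<open>u\<close> of \<open>v\<close> other than \<open>w\<close>
  is not on \<open>v, w, ...\<close>, again for lack of chords, so it can replace \<open>x\<close> as the start of a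
  longest path and is a leaf as well. Nothing is claimed about \<open>w\<close>: it may be a leaf, and if the
  path ends at \<open>v\<close> it is an arbitrary value.
\<close>

lemma forest_has_vertex_beside_leaves:
  assumes F: "forest F" and S: "S \<subseteq> verts F" "finite S"
    and edge: "a \<in> S" "b \<in> S" "{a, b} \<in> edges F"
  obtains v w where "v \<in> S" "\<exists>u \<in> nbrs F S v. nbrs F S u = {v}"
    "\<And>u. u \<in> nbrs F S v \<Longrightarrow> u \<noteq> w \<Longrightarrow> nbrs F S u = {v}"
proof -
  let ?path = "\<lambda>p. set p \<subseteq> S \<and> distinct p \<and> successively (\<lambda>a b. {a, b} \<in> edges F) p"
  have "a \<noteq> b"
    using F edge not_self_adjacent by (metis forest_def)
  then have "?path [a, b]"
    using edge by simp
  moreover have "\<forall>p. ?path p \<longrightarrow> length p < Suc (card S)"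
    using S by (metis card_mono distinct_card less_Suc_eq_le)
  ultimately have "\<exists>p. ?path p \<and> (\<forall>q. ?path q \<longrightarrow> length q \<le> length p)"
    by (rule ex_has_greatest_nat[where P = ?path])
  then obtain p where p: "?path p" and longest: "\<forall>q. ?path q \<longrightarrow> length q \<le> length p"
    by (elim exE conjE) (rule that, intro conjI)
  have max: "length q \<le> length p" if "?path q" for q
    using longest that by simp
  have "2 \<le> length p"
    using max[OF \<open>?path [a, b]\<close>] by simp
  then obtain x v r where p_eq: "p = x # v # r"
    by (metis One_nat_def Suc_le_length_iff numeral_2_eq_2)
  have end_leaf: "nbrs F S u = {v}" if u: "?path (u # v # r)" for u
  proof -
    have "y = v" if y: "y \<in> S" "{u, y} \<in> edges F" for y
    proof -
      have "y \<in> set (u # v # r)"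
      proof (rule ccontr)
        assume "y \<notin> set (u # v # r)"
        then have "?path (y # u # v # r)"
          using u y by (auto simp: insert_commute)
        from max[OF this] show False
          by (simp add: p_eq)
      qed
      then obtain j where j: "j < length (u # v # r)" "(u # v # r) ! j = y"
        by (metis in_set_conv_nth)
      then have "j = 1"
        using path_chord_free[OF F, of "u # v # r" j] u y S by auto
      then show ?thesis
        using j by simp
    qed
    then show ?thesis
      using u by (auto simp: nbrs_def)
  qed
  show thesis
  proof (rule that[of v "r ! 0"])
    show "v \<in> S"
      using p p_eq by simp
    have "x \<in> nbrs F S v"
      using p p_eq adjacent_sym[of v x F] by (simp add: nbrs_def)
    then show "\<exists>u \<in> nbrs F S v. nbrs F S u = {v}"
      using p p_eq end_leaf[of x] by blast
    fix u assume u: "u \<in> nbrs F S v" "u \<noteq> r ! 0"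
    have "u \<notin> set (v # r)"
    proof
      assume "u \<in> set (v # r)"
      then obtain j where j: "j < length (v # r)" "(v # r) ! j = u"
        by (metis in_set_conv_nth)
      moreover have "?path (v # r)"
        using p p_eq by simp
      ultimately have "j = 1"
        using path_chord_free[OF F, of "v # r" j] u S by (auto simp: nbrs_def)
      then show False
        using j u by simp
    qed
    then have "?path (u # v # r)"
      using p p_eq u by (auto simp: nbrs_def insert_commute)
    then show "nbrs F S u = {v}"
      by (rule end_leaf)
  qed
qed

section \<open>The bound for all vertex sets of a forest\<close>

lemma pow2_bounds:
  assumes "1 \<le> (k::nat)"
  shows "12 * k \<le> (3 * k + 3) * 2 ^ k" "12 \<le> (3 * k + 3) * 2 ^ k"
    "12 * k \<le> (3 * k + 1) * (2 ^ k + 1)"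
proof -
  have *: "12 * k \<le> (3 * k + 3) * 2 ^ k \<and> 12 * k \<le> (3 * k + 1) * (2 ^ k + 1)"
  proof (cases "k = 1")
    case False
    then have "(2::nat) ^ 2 \<le> 2 ^ k"
      using assms by (intro power_increasing) auto
    then have "(3 * k + 3) * 4 \<le> (3 * k + 3) * 2 ^ k" "(3 * k + 1) * 5 \<le> (3 * k + 1) * (2 ^ k + 1)"
      by (intro mult_left_mono; simp)+
    moreover have "12 * k \<le> (3 * k + 3) * 4" "12 * k \<le> (3 * k + 1) * 5"
      using assms by auto
    ultimately show ?thesis
      using le_trans by blast
  qed simp
  then show "12 * k \<le> (3 * k + 3) * 2 ^ k" "12 * k \<le> (3 * k + 1) * (2 ^ k + 1)"
    by auto
  then show "12 \<le> (3 * k + 3) * 2 ^ k"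
    using assms by linarith
qed

text \<open>
  In the two step lemmas, \<open>h\<close> is the order of the part left after the deletions, for which
  the bound is assumed. The star needs its own treatment of \<open>h = 0\<close>, where the bound fails.
\<close>

lemma star_step:
  fixes k h i e :: nat
  assumes "1 \<le> k" and "if h = 0 then e = 0 else 12 * e + 2 * i \<le> 3 * h * i"
  shows "12 * (2 ^ k * e + e + k * i) + 2 * (2 ^ k * i + i) \<le> 3 * (h + k + 1) * (2 ^ k * i + i)"
proof -
  have "12 * k * i \<le> (3 * k + 1) * (2 ^ k + 1) * i"
    using pow2_bounds(3)[OF assms(1)] by (rule mult_right_mono) simp
  moreover have "(2 ^ k + 1) * (12 * e) \<le> (2 ^ k + 1) * (3 * h * i)"
    using assms(2) by (intro mult_left_mono) (auto split: if_splits)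
  ultimately show ?thesis
    by (simp add: algebra_simps)
qed

text \<open>
  Here \<open>x + y\<close>, \<open>e\<close> and \<open>Suc h\<close> belong to \<open>H\<close>, and \<open>x\<close>, \<open>e'\<close> and \<open>h\<close> to \<open>H\<close> without \<open>w\<close>.
\<close>

lemma branch_step:
  fixes k h x y e e' :: nat
  assumes "1 \<le> k" and "12 * e + 2 * (x + y) \<le> 3 * Suc h * (x + y)" and "12 * e' + 2 * x \<le> 3 * h * x"
  shows "12 * (2 ^ k * e + e' + (k * x + y)) + 2 * (2 ^ k * (x + y) + x)
    \<le> 3 * (Suc h + k + 1) * (2 ^ k * (x + y) + x)"
proof -
  have "12 * k * x \<le> (3 * k + 3) * 2 ^ k * x" "12 * y \<le> (3 * k + 3) * 2 ^ k * y"
    using pow2_bounds(1,2)[OF assms(1)] by (auto intro: mult_right_mono)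
  moreover have "2 ^ k * (12 * e + 2 * (x + y)) \<le> 2 ^ k * (3 * Suc h * (x + y))"
    using assms(2) by (rule mult_left_mono) simp
  ultimately show ?thesis
    using assms(3) by (simp add: algebra_simps)
qed

text \<open>
  The bound is false for the empty set, which has the ratio \<open>0\<close>. So each use of the induction
  hypothesis needs a nonempty remainder; in the branching case this holds because \<open>w\<close>, not
  being a leaf, has a neighbour that survives the deletion of \<open>v\<close>, its leaves and \<open>w\<close>.
\<close>

lemma forest_count_bound:
  assumes F: "forest F" and "S \<subseteq> verts F" "S \<noteq> {}"
  shows "12 * count_sets F 1 S + 2 * count_sets F 0 S \<le> 3 * card S * count_sets F 0 S"
  using assms(2,3)
proof (induction "card S" arbitrary: S rule: less_induct)
  case less
  have G: "simple_graph F"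
    using F by (simp add: forest_def)
  have fin: "finite S"
    using less.prems G by (auto simp: simple_graph_def intro: finite_subset)
  have empty: "count_sets F 1 {} = 0"
    by (simp add: sets_with_edges_def edges_in_empty[OF G] cong: conj_cong)
  have IH: "12 * count_sets F 1 T + 2 * count_sets F 0 T \<le> 3 * card T * count_sets F 0 T"
    if "T \<subset> S" "T \<noteq> {}" for T
    using that less fin by (intro less.hyps psubset_card_mono) auto
  show ?case
  proof (cases "\<exists>v \<in> S. nbrs F S v = {}")
    case True
    then obtain v where v: "v \<in> S" "nbrs F S v = {}" by blast
    let ?T = "S - {v}"
    have S_eq: "S = insert v ?T"
      using v by auto
    have "nbrs F ?T v = {}"
      using v by (auto simp: nbrs_def)
    then have cs: "count_sets F k S = 2 * count_sets F k ?T" for k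
      using fin by (subst S_eq, intro count_sets_insert_isolated[OF G]) auto
    have cardS: "card S = Suc (card ?T)"
      using fin v by (metis card_Suc_Diff1)
    have double: "12 * (2 * e) + 2 * (2 * i) \<le> 3 * Suc h * (2 * i)"
      if "12 * e + 2 * i \<le> 3 * h * i" for e i h :: nat
      using that by (simp add: algebra_simps)
    have T: "?T \<subset> S"
      using v by auto
    show ?thesis
    proof (cases "?T = {}")
      case True
      then show ?thesis
        unfolding cs cardS True empty by simp
    next
      case False
      then show ?thesis
        using double[OF IH[OF T False]] by (simp only: cs cardS)
    qed
  next
    case False
    then obtain a b where "a \<in> S" "b \<in> S" "{a, b} \<in> edges F"
      using less.prems by (fastforce simp: nbrs_def)
    then obtain v w where v: "v \<in> S" and ex: "\<exists>u \<in> nbrs F S v. nbrs F S u = {v}"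
      and others: "\<And>u. u \<in> nbrs F S v \<Longrightarrow> u \<noteq> w \<Longrightarrow> nbrs F S u = {v}"
      using forest_has_vertex_beside_leaves[OF F less.prems(1) fin] by metis
    define R where "R = S - {v}"
    define L where "L = {u \<in> nbrs F S v. nbrs F S u = {v}}"
    define H where "H = R - L"
    define k where "k = card L"
    have S_eq: "S = insert v R" and R: "finite R" "v \<notin> R"
      using v fin by (auto simp: R_def)
    have vv: "{v, v} \<notin> edges F"
      by (rule not_self_adjacent[OF G])
    have L: "L \<subseteq> R" "finite L"
      using vv R by (auto simp: L_def R_def nbrs_def intro: finite_subset)
    have R_eq: "R = L \<union> H" "L \<inter> H = {}" "finite H"
      using L R by (auto simp: H_def)
    have k: "1 \<le> k"
      using ex L by (auto simp: k_def L_def Suc_le_eq card_gt_0_iff)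
    have leaf: "nbrs F R u = {}" if "u \<in> L" for u
      using that by (auto simp: L_def R_def nbrs_def)
    have cR: "count_sets F m R = 2 ^ k * count_sets F m H" for m
      unfolding R_eq(1) k_def using R_eq L leaf by (intro count_sets_Un_isolated[OF G]) auto
    have cardS: "card S = card H + k + 1"
      using R R_eq L by (simp add: S_eq k_def card_Un_disjoint)
    have HS: "H \<subset> S"
      using v by (auto simp: H_def R_def)
    have NR: "nbrs F R v = nbrs F S v"
      using vv by (auto simp: R_def nbrs_def)
    show ?thesis
    proof (cases "nbrs F S v = L")
      case True
      \<comment> \<open>\<open>v\<close> and its leaves form a component of their own.\<close>
      have "R - L - nbrs F R u = H" if "u \<in> L" for u
        using leaf[OF that] by (simp add: H_def)
      then have "count_sets F 1 S = 2 ^ k * count_sets F 1 H + count_sets F 1 H + k * count_sets F 0 H"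
        using count_one_edge_insert[OF G R] by (simp add: S_eq[symmetric] NR True cR H_def[symmetric] k_def)
      moreover have "count_sets F 0 S = 2 ^ k * count_sets F 0 H + count_sets F 0 H"
        using count_independent_insert[OF G R] by (simp add: S_eq[symmetric] NR True cR H_def[symmetric])
      moreover have "if card H = 0 then count_sets F 1 H = 0
          else 12 * count_sets F 1 H + 2 * count_sets F 0 H \<le> 3 * card H * count_sets F 0 H"
        using IH[OF HS] R_eq(3) empty by auto
      ultimately show ?thesis
        using star_step[OF k] by (simp only: cardS)
    next
      case False
      then have w: "w \<in> nbrs F S v" "nbrs F S w \<noteq> {v}" "nbrs F S v = insert w L" "w \<notin> L"
        using others by (auto simp: L_def)
      define T where "T = H - {w}"
      have wH: "w \<in> H"
        using w vv by (auto simp: H_def R_def nbrs_def)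
      have H_eq: "H = insert w T" and T: "finite T" "w \<notin> T"
        using wH R_eq by (auto simp: T_def)
      \<comment> \<open>A second neighbour \<open>z\<close> of \<open>w\<close> shows that \<open>H\<close> without \<open>w\<close> is nonempty.\<close>
      have "v \<in> nbrs F S w"
        using w(1) v adjacent_sym[of v w F] by (simp add: nbrs_def)
      then obtain z where "z \<in> nbrs F S w" "z \<noteq> v"
        using w(2) by blast
      then have z: "z \<in> S" "{w, z} \<in> edges F" "z \<noteq> v"
        by (auto simp: nbrs_def)
      have "w \<in> nbrs F S z"
        using z(2) w(1) adjacent_sym[of w z F] by (simp add: nbrs_def)
      moreover have "w \<noteq> v"
        using w(1) vv by (auto simp: nbrs_def)
      ultimately have "z \<notin> L"
        by (auto simp: L_def)
      moreover have "z \<noteq> w"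
        using z not_self_adjacent[OF G] by auto
      ultimately have "z \<in> T"
        using z by (auto simp: T_def H_def R_def)
      then have "T \<noteq> {}" by auto
      have RT: "R - insert w L = T"
        by (auto simp: T_def H_def)
      have Tw: "T - nbrs F R w = T - nbrs F T w"
        by (auto simp: nbrs_def T_def H_def)
      have "R - insert w L - nbrs F R u = T" if "u \<in> L" for u
        using leaf[OF that] by (simp add: RT)
      then have one: "count_sets F 1 S = 2 ^ k * count_sets F 1 H + count_sets F 1 T
          + (k * count_sets F 0 T + count_sets F 0 (T - nbrs F T w))"
        using count_one_edge_insert[OF G R] w(4) L
        by (simp add: S_eq[symmetric] NR w(3) cR RT Tw k_def)
      have H0: "count_sets F 0 H = count_sets F 0 T + count_sets F 0 (T - nbrs F T w)"
        using count_independent_insert[OF G T] by (simp add: H_eq[symmetric])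
      have zero: "count_sets F 0 S = 2 ^ k * (count_sets F 0 T + count_sets F 0 (T - nbrs F T w))
          + count_sets F 0 T"
        using count_independent_insert[OF G R] by (simp add: S_eq[symmetric] NR w(3) cR RT H0)
      have cardH: "card H = Suc (card T)"
        using T by (simp add: H_eq)
      have bT: "12 * count_sets F 1 T + 2 * count_sets F 0 T \<le> 3 * card T * count_sets F 0 T"
        using HS \<open>T \<noteq> {}\<close> by (intro IH) (auto simp: T_def)
      have bH: "12 * count_sets F 1 H + 2 * count_sets F 0 H \<le> 3 * card H * count_sets F 0 H"
        using wH by (intro IH[OF HS]) auto
      show ?thesis
        using branch_step[OF k bH[unfolded H0 cardH] bT] by (simp only: cardS cardH one zero)
    qed
  qed
qed

theorem theorem6:
  fixes F :: "'a graph" and n :: nat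
  assumes "forest F"
    and "card (verts F) = n"
    and "n \<ge> 1"
  shows "ratio_Q F \<le> 1 / 4 * real n - 1 / 6"
proof -
  have "verts F \<noteq> {}"
    using assms by auto
  then have "12 * sigma 1 F + 2 * sigma 0 F \<le> 3 * n * sigma 0 F"
    using forest_count_bound[OF assms(1) subset_refl] assms(2) by (simp add: sigma_eq_count_sets)
  then have "real (12 * sigma 1 F + 2 * sigma 0 F) \<le> real (3 * n * sigma 0 F)"
    by (rule of_nat_mono)
  moreover have "0 < real (sigma 0 F)"
    using assms(1) sigma_0_pos by (auto simp: forest_def)
  ultimately show ?thesis
    by (simp add: ratio_Q_def field_simps)
qed

end
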